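(* Let $(M,f)$ be a minimal non-totally geodesic parametric isotropic surface of $\mathbb S^3_1(1)$ given by $f=\frac12(\mu W(x,y)+\bar\mu\,\overline{W(x,y)})$ with $|\mu|^2\langle W(x,y),\overline{W(x,y)}\rangle^{\mathbb C}=2$, equipped with Gauss map $\nu=\frac1{2i}(\mu W(x,y)-\bar\mu\,\overline{W(x,y)})$. Then $(M,\nu)$ is also a minimal non-totally geodesic isotropic surface in $\mathbb S^3_1(1)$, with Gauss map $f(w)$. Moreover, the isotropic condition for $(M,\nu)$ is given by the equations $$\operatorname{Im}\big(\mu\langle W_w,L(y)\rangle^{\mathbb C}-\bar\mu\langle\overline W_w,L(y)\rangle^{\mathbb C}\big)=0,\qquad \operatorname{Re}\big(\mu\langle W_w,L(x)\rangle^{\mathbb C}-\bar\mu\langle\overline W_w,L(x)\rangle^{\mathbb C}\big)=0,$$ where $W=W(x(w),y(w))$ and $\overline W_w=\partial_w(\overline W)$.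
   Context: $\mathbb R^4_1$ is $\mathbb R^4$ with $\langle p,q\rangle=-p^1q^1+p^2q^2+p^3q^3+p^4q^4$, oriented by its canonical basis and time-oriented by the first basis vector; $\mathbb S^3_1(1)=\{p:\langle p,p\rangle=1\}$; $\langle\cdot,\cdot\rangle^{\mathbb C}$ is the complex bilinear extension to $\mathbb C^4$. $M\subset\mathbb C$ is open, connected and simply connected, with points $w=u+iv$; $\partial_w=\frac12(\partial_u-i\partial_v)$. All functions are smooth. An isotropic surface $(M,f)$ of $\mathbb S^3_1(1)$ is a smooth $f:M\to\mathbb R^4_1$, a homeomorphism onto its image, with $\langle f,f\rangle=1$, $f_u,f_v$ linearly independent future directed lightlike vectors (induced metric $2F\,du\,dv$, $F=\langle f_u,f_v\rangle$). Its Gauss map is $\nu:M\to\mathbb S^3_1(1)$ with $\langle\nu,\nu\rangle=1$, $\langle\nu,f\rangle=\langle\nu,f_u\rangle=\langle\nu,f_v\rangle=0$ and $\{f,f_u,f_v,\nu\}$ positively oriented; it is assumed non-constant. Minimal means zero mean curvature in $\mathbb S^3_1(1)$. For $x\neq y$ in $\mathbb C$: $L(x)=(1+x\bar x,x+\bar x,-i(x-\bar x),-1+x\bar x)$ and $W(x,y)=(1+x\bar y,x+\bar y,-i(x-\bar y),-1+x\bar y)$. Here $x,y,\mu:M\to\mathbb C$ are smooth, $x\ne y$ everywhere, with $f_u=\alpha L(x)$, $f_v=\beta L(y)$ for real-valued functions $\alpha,\beta$. The isotropic condition for $(M,\nu)$ is the condition that $u,v$ are null coordinates for $\nu$ with $\nu_u$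 a real multiple of $L(y)$ and $\nu_v$ a real multiple of $L(x)$.
   Formalization: The claim that (M,ν) is an isotropic surface with Gauss map f is replaced by: it is one iff ν is a homeomorphism onto its image and ⟨f_uu,ν⟩, ⟨f_vv,ν⟩ > 0 on M, and then f is its Gauss map; in general ν_u, ν_v may vanish or be past directed. *)

theory Defs
  imports "HOL-Analysis.Analysis"
begin

section \<open>Calculus on plane domains, with parameter $w = u + iv$\<close>

definition du :: "(complex \<Rightarrow> 'a::real_normed_vector) \<Rightarrow> complex \<Rightarrow> 'a" where
  "du g w = frechet_derivative g (at w) 1"

definition dv :: "(complex \<Rightarrow> 'a::real_normed_vector) \<Rightarrow> complex \<Rightarrow> 'a" where
  "dv g w = frechet_derivative g (at w) \<i>"

definition dw :: "(complex \<Rightarrow> complex^'n) \<Rightarrow> complex \<Rightarrow> complex^'n" where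
  "dw g w = (1/2) *s (du g w - \<i> *s dv g w)"

text \<open>On an open set, the functions of class $C^k$ in the real sense.\<close>

primrec Ck_on :: "nat \<Rightarrow> complex set \<Rightarrow> (complex \<Rightarrow> 'a::real_normed_vector) \<Rightarrow> bool" where
  "Ck_on 0 M g \<longleftrightarrow> continuous_on M g"
| "Ck_on (Suc k) M g \<longleftrightarrow>
     (\<forall>w\<in>M. g differentiable (at w)) \<and> Ck_on k M (du g) \<and> Ck_on k M (dv g)"

definition smooth_on :: "complex set \<Rightarrow> (complex \<Rightarrow> 'a::real_normed_vector) \<Rightarrow> bool" where
  "smooth_on M g \<longleftrightarrow> (\<forall>k. Ck_on k M g)"


section \<open>Minkowski space\<close>

text \<open>At type \<^typ>\<open>real^4\<close> this is the Lorentz product, at type \<^typ>\<open>complex^4\<close> its complex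
  bilinear (not sesquilinear) extension.\<close>

definition mink :: "'a::comm_ring_1^4 \<Rightarrow> 'a^4 \<Rightarrow> 'a" where
  "mink p q = - (p$1 * q$1) + p$2 * q$2 + p$3 * q$3 + p$4 * q$4"

definition lightlike :: "real^4 \<Rightarrow> bool" where
  "lightlike p \<longleftrightarrow> p \<noteq> 0 \<and> mink p p = 0"

text \<open>Used for causal vectors only.\<close>

definition future_directed :: "real^4 \<Rightarrow> bool" where
  "future_directed p \<longleftrightarrow> mink p (axis 1 1) < 0"

definition positively_oriented :: "real^4 \<Rightarrow> real^4 \<Rightarrow> real^4 \<Rightarrow> real^4 \<Rightarrow> bool" where
  "positively_oriented a b c d \<longleftrightarrow> det (vector [a, b, c, d] :: real^4^4) > 0"

definition cplx :: "real^'n \<Rightarrow> complex^'n" where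
  "cplx p = (\<chi> i. complex_of_real (p $ i))"

definition vcnj :: "complex^'n \<Rightarrow> complex^'n" where
  "vcnj p = (\<chi> i. cnj (p $ i))"

definition L :: "complex \<Rightarrow> complex^4" where
  "L x = vector [1 + x * cnj x, x + cnj x, - \<i> * (x - cnj x), - 1 + x * cnj x]"

definition W :: "complex \<Rightarrow> complex \<Rightarrow> complex^4" where
  "W x y = vector [1 + x * cnj y, x + cnj y, - \<i> * (x - cnj y), - 1 + x * cnj y]"


section \<open>Isotropic surfaces in de Sitter space\<close>

definition isotropic_surface :: "complex set \<Rightarrow> (complex \<Rightarrow> real^4) \<Rightarrow> bool" where
  "isotropic_surface M f \<longleftrightarrow>
     open M \<and> connected M \<and> simply_connected M \<and>
     smooth_on M f \<and> (\<exists>g. homeomorphism M (f ` M) f g) \<and>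
     (\<forall>w\<in>M. mink (f w) (f w) = 1 \<and>
        lightlike (du f w) \<and> future_directed (du f w) \<and>
        lightlike (dv f w) \<and> future_directed (dv f w) \<and>
        du f w \<noteq> dv f w \<and> independent {du f w, dv f w})"

definition unit_normal :: "complex set \<Rightarrow> (complex \<Rightarrow> real^4) \<Rightarrow> (complex \<Rightarrow> real^4) \<Rightarrow> bool" where
  "unit_normal M f n \<longleftrightarrow>
     smooth_on M n \<and>
     (\<forall>w\<in>M. mink (n w) (n w) = 1 \<and> mink (n w) (f w) = 0 \<and>
        mink (n w) (du f w) = 0 \<and> mink (n w) (dv f w) = 0)"

definition gauss_map :: "complex set \<Rightarrow> (complex \<Rightarrow> real^4) \<Rightarrow> (complex \<Rightarrow> real^4) \<Rightarrow> bool" where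
  "gauss_map M f n \<longleftrightarrow>
     unit_normal M f n \<and>
     (\<forall>w\<in>M. positively_oriented (f w) (du f w) (dv f w) (n w)) \<and>
     \<not> n constant_on M"

text \<open>Coefficients of the second fundamental form of \<open>f\<close> in de Sitter space with respect to
  the unit normal \<open>n\<close>. The flat second derivatives may be used, since \<open>n\<close> is orthogonal to the
  position vector \<open>f\<close>, which is the normal of de Sitter space.\<close>

definition II_uu :: "(complex \<Rightarrow> real^4) \<Rightarrow> (complex \<Rightarrow> real^4) \<Rightarrow> complex \<Rightarrow> real" where
  "II_uu f n w = mink (du (du f) w) (n w)"

definition II_uv :: "(complex \<Rightarrow> real^4) \<Rightarrow> (complex \<Rightarrow> real^4) \<Rightarrow> complex \<Rightarrow> real" where
  "II_uv f n w = mink (dv (du f) w) (n w)"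

definition II_vv :: "(complex \<Rightarrow> real^4) \<Rightarrow> (complex \<Rightarrow> real^4) \<Rightarrow> complex \<Rightarrow> real" where
  "II_vv f n w = mink (dv (dv f) w) (n w)"

text \<open>Half the trace of the second fundamental form with respect to the induced metric. It is
  meaningful only where \<open>f\<close> is a nondegenerate immersion; elsewhere the denominator is 0 and so
  is the value of the quotient.\<close>

definition mean_curvature :: "(complex \<Rightarrow> real^4) \<Rightarrow> (complex \<Rightarrow> real^4) \<Rightarrow> complex \<Rightarrow> real" where
  "mean_curvature f n w =
     (let E = mink (du f w) (du f w); F = mink (du f w) (dv f w); G = mink (dv f w) (dv f w)
      in (E * II_vv f n w - 2 * F * II_uv f n w + G * II_uu f n w) / (2 * (E * G - F\<^sup>2)))"

definition minimal :: "complex set \<Rightarrow> (complex \<Rightarrow> real^4) \<Rightarrow> (complex \<Rightarrow> real^4) \<Rightarrow> bool" where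
  "minimal M f n \<longleftrightarrow> (\<forall>w\<in>M. mean_curvature f n w = 0)"

definition totally_geodesic :: "complex set \<Rightarrow> (complex \<Rightarrow> real^4) \<Rightarrow> (complex \<Rightarrow> real^4) \<Rightarrow> bool" where
  "totally_geodesic M f n \<longleftrightarrow> (\<forall>w\<in>M. II_uu f n w = 0 \<and> II_uv f n w = 0 \<and> II_vv f n w = 0)"

text \<open>The isotropic condition for \<open>n\<close> at \<open>w\<close>. The factors \<open>a\<close> and \<open>b\<close> may vanish or be negative,
  so \<open>n\<close> need be neither immersed nor future directed.\<close>

definition isotropic_condition ::
    "(complex \<Rightarrow> complex) \<Rightarrow> (complex \<Rightarrow> complex) \<Rightarrow> (complex \<Rightarrow> real^4) \<Rightarrow> complex \<Rightarrow> bool" where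
  "isotropic_condition x y n w \<longleftrightarrow>
     mink (du n w) (du n w) = 0 \<and> mink (dv n w) (dv n w) = 0 \<and>
     (\<exists>a. cplx (du n w) = complex_of_real a *s L (y w)) \<and>
     (\<exists>b. cplx (dv n w) = complex_of_real b *s L (x w))"

end

theory Submission
  imports Defs
begin

text \<open>
Put \<open>F = \<langle>f\<^sub>u,f\<^sub>v\<rangle>\<close>, which is negative because \<open>f\<^sub>u\<close> and \<open>f\<^sub>v\<close> are independent
future directed null vectors. The vectors \<open>f, f\<^sub>u, f\<^sub>v, \<nu>\<close> form a frame, and the derivatives of \<open>\<nu>\<close> are
orthogonal to \<open>f\<close> and \<open>\<nu>\<close>. Expanding them in the null basis of the tangent plane gives the Weingarten
equations (\<open>normal_derivative\<close>)

  \<open>\<nu>\<^sub>u = - (II_uv / F) f\<^sub>u - (II_uu / F) f\<^sub>v\<close> and \<open>\<nu>\<^sub>v = - (II_vv / F) f\<^sub>u - (II_uv / F) f\<^sub>v\<close>.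

In null coordinates the mean curvature is \<open>II_uv / F\<close>, so minimality says exactly that \<open>II_uv = 0\<close>,
that is, that \<open>\<nu>\<^sub>u\<close> is a multiple of \<open>f\<^sub>v\<close> and \<open>\<nu>\<^sub>v\<close> a multiple of \<open>f\<^sub>u\<close>. This is the isotropic
condition for \<open>\<nu>\<close>. The factors are \<open>- II_uu / F\<close> and \<open>- II_vv / F\<close>, so their signs decide where \<open>\<nu>\<close> is
an immersion and where its null derivatives are future directed. The relation between \<open>f\<close> and \<open>\<nu>\<close> is
symmetric: both are unit vectors, each is orthogonal to the derivatives of the other, and the second
fundamental form of \<open>\<nu>\<close> with respect to \<open>f\<close> has the same coefficients as that of \<open>f\<close> with respect to \<open>\<nu>\<close>
(\<open>second_form_swap\<close>). Minimality and not being totally geodesic therefore pass from \<open>f\<close> to \<open>\<nu>\<close>.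
The frame of \<open>\<nu>\<close> is that of \<open>f\<close> in reverse order, up to the two factors, and reversing four vectors
is an even permutation, so the orientation is preserved (\<open>det_reverse_scale\<close>).

The two displayed equations are the equation \<open>II_uv = 0\<close> again. Since \<open>W\<close> and its conjugate are
orthogonal to \<open>L x\<close> and \<open>L y\<close> (\<open>mink_W_L\<close>), pairing \<open>2 \<i> \<nu>\<^sub>w\<close> with these vectors eliminates the derivatives
of \<open>\<mu>\<close> and produces the expressions in the statement (\<open>dw_pairing\<close>). With \<open>f\<^sub>v = \<beta> L y\<close> and
\<open>f\<^sub>u = \<alpha> L x\<close>, where \<open>\<alpha>\<close> and \<open>\<beta>\<close> do not vanish, the imaginary part of the first is
\<open>\<langle>\<nu>\<^sub>u,f\<^sub>v\<rangle> / \<beta>\<close> and the real part of the second is \<open>\<langle>\<nu>\<^sub>v,f\<^sub>u\<rangle> / \<alpha>\<close>. Both products equal \<open>- II_uv\<close>; for the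
first one this uses the symmetry of second derivatives (\<open>mixed_partials\<close>).
\<close>

section \<open>Calculus in the parameter plane\<close>

lemma smooth_onD:
  assumes "smooth_on M g"
  shows "w \<in> M \<Longrightarrow> g differentiable (at w)" "smooth_on M (du g)" "smooth_on M (dv g)"
    "continuous_on M g"
proof -
  have "Ck_on (Suc k) M g" for k using assms unfolding smooth_on_def by blast
  then show "w \<in> M \<Longrightarrow> g differentiable (at w)" "smooth_on M (du g)" "smooth_on M (dv g)"
    unfolding smooth_on_def by auto
  show "continuous_on M g" using assms unfolding smooth_on_def by (metis Ck_on.simps(1))
qed

lemma frechet_derivative_cong_open:
  assumes "open M" "w \<in> M" "\<And>z. z \<in> M \<Longrightarrow> g z = h z"
  shows "frechet_derivative g (at w) = frechet_derivative h (at w)"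
proof -
  have "(g has_derivative D) (at w) \<longleftrightarrow> (h has_derivative D) (at w)" for D
    using has_derivative_transform_within_open[OF _ assms(1,2)] assms(3) by metis
  then show ?thesis unfolding frechet_derivative_def by simp
qed

lemma frechet_derivative_bilinear:
  assumes "bounded_bilinear B" "g differentiable (at w)" "h differentiable (at w)"
  shows "frechet_derivative (\<lambda>z. B (g z) (h z)) (at w) a =
           B (frechet_derivative g (at w) a) (h w) + B (g w) (frechet_derivative h (at w) a)"
proof -
  have "((\<lambda>z. B (g z) (h z)) has_derivative
      (\<lambda>a. B (g w) (frechet_derivative h (at w) a) + B (frechet_derivative g (at w) a) (h w))) (at w)"
    by (intro bounded_bilinear.FDERIV[OF assms(1)] assms(2,3)[unfolded frechet_derivative_works])
  from frechet_derivative_at[OF this, symmetric] show ?thesis by simp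
qed

lemma frechet_derivative_linear:
  assumes "bounded_linear T" "g differentiable (at w)"
  shows "frechet_derivative (\<lambda>z. T (g z)) (at w) a = T (frechet_derivative g (at w) a)"
proof -
  have "((\<lambda>z. T (g z)) has_derivative (\<lambda>a. T (frechet_derivative g (at w) a))) (at w)"
    by (intro bounded_linear.has_derivative[OF assms(1)] assms(2)[unfolded frechet_derivative_works])
  from frechet_derivative_at[OF this, symmetric] show ?thesis by simp
qed

lemma differentiable_bilinear:
  assumes "bounded_bilinear B" "g differentiable (at w)" "h differentiable (at w)"
  shows "(\<lambda>z. B (g z) (h z)) differentiable (at w)"
  using bounded_bilinear.FDERIV[OF assms(1)] assms(2,3) unfolding differentiable_def by blast

lemma differentiable_linear:
  assumes "bounded_linear T" "g differentiable (at w)"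
  shows "(\<lambda>z. T (g z)) differentiable (at w)"
  using bounded_linear.has_derivative[OF assms(1)] assms(2) unfolding differentiable_def by blast

text \<open>The left side is symmetric in \<open>a\<close> and \<open>b\<close>, so applying this twice compares the two mixed
derivatives at nearby points. The mean value theorem holds only for real-valued functions;
pairing with a fixed vector \<open>c\<close> supplies one.\<close>

lemma second_difference_mvt:
  fixes g :: "complex \<Rightarrow> 'a::real_inner"
  assumes g: "\<And>z. dist z w \<le> 2 * h \<Longrightarrow> g differentiable (at z)"
    and ga: "\<And>z. dist z w \<le> 2 * h \<Longrightarrow> (\<lambda>z. frechet_derivative g (at z) a) differentiable (at z)"
    and h: "0 < h" and norm: "norm a = 1" "norm b = 1"
  obtains p where "dist p w \<le> 2 * h"
    "(g (w + h *\<^sub>R a + h *\<^sub>R b) - g (w + h *\<^sub>R a) - g (w + h *\<^sub>R b) + g w) \<bullet> c =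
       h\<^sup>2 * (frechet_derivative (\<lambda>z. frechet_derivative g (at z) a) (at p) b \<bullet> c)"
proof -
  define D where "D \<equiv> (\<lambda>z. frechet_derivative g (at z) a)"
  \<comment> \<open>The factor 2 in the hypotheses: the two steps of length at most \<open>h\<close> stay within distance \<open>2 h\<close>.\<close>
  have near: "dist (w + s *\<^sub>R a + t *\<^sub>R b) w \<le> 2 * h" if "0 \<le> s" "s \<le> h" "0 \<le> t" "t \<le> h" for s t
    using norm_triangle_ineq[of "s *\<^sub>R a" "t *\<^sub>R b"] that norm by (simp add: dist_norm)
  have line: "((\<lambda>s. k (z + s *\<^sub>R e) \<bullet> c) has_derivative
      (\<lambda>r. r * (frechet_derivative k (at (z + s *\<^sub>R e)) e \<bullet> c))) (at s within S)"
    if "k differentiable (at (z + s *\<^sub>R e))" for k :: "complex \<Rightarrow> 'a" and z e s S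
  proof -
    let ?K = "frechet_derivative k (at (z + s *\<^sub>R e))"
    have K: "(k has_derivative ?K) (at (z + s *\<^sub>R e))"
      using that frechet_derivative_works by blast
    have "((\<lambda>s. z + s *\<^sub>R e) has_derivative (\<lambda>r. r *\<^sub>R e)) (at s within S)"
      by (auto intro!: derivative_eq_intros)
    from has_derivative_inner_left[OF has_derivative_compose[OF this K], of c] show ?thesis
      using linear_frechet_derivative[OF that] by (simp add: linear_cmul)
  qed
  have "\<exists>s\<in>{0<..<h}. (g ((w + h *\<^sub>R b) + h *\<^sub>R a) \<bullet> c - g (w + h *\<^sub>R a) \<bullet> c) -
      (g ((w + h *\<^sub>R b) + 0 *\<^sub>R a) \<bullet> c - g (w + 0 *\<^sub>R a) \<bullet> c) =
      (h - 0) * (D ((w + h *\<^sub>R b) + s *\<^sub>R a) \<bullet> c) - (h - 0) * (D (w + s *\<^sub>R a) \<bullet> c)"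
    unfolding D_def
  proof (rule mvt_simple[OF h])
    fix s assume "0 \<le> s" "s \<le> h"
    then show "((\<lambda>s. g ((w + h *\<^sub>R b) + s *\<^sub>R a) \<bullet> c - g (w + s *\<^sub>R a) \<bullet> c) has_derivative
      (\<lambda>r. r * (frechet_derivative g (at ((w + h *\<^sub>R b) + s *\<^sub>R a)) a \<bullet> c) -
           r * (frechet_derivative g (at (w + s *\<^sub>R a)) a \<bullet> c))) (at s within {0..h})"
      using near[of s h] near[of s 0] h
      by (intro has_derivative_diff line g) (simp_all add: add_ac)
  qed
  then obtain s where s: "0 < s" "s < h" and
    S: "(g (w + h *\<^sub>R a + h *\<^sub>R b) - g (w + h *\<^sub>R a) - g (w + h *\<^sub>R b) + g w) \<bullet> c =
      h * (D (w + s *\<^sub>R a + h *\<^sub>R b) \<bullet> c - D (w + s *\<^sub>R a) \<bullet> c)"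
    by (auto simp: algebra_simps)
  have "\<exists>t\<in>{0<..<h}. D (w + s *\<^sub>R a + h *\<^sub>R b) \<bullet> c - D (w + s *\<^sub>R a + 0 *\<^sub>R b) \<bullet> c =
      (h - 0) * (frechet_derivative D (at (w + s *\<^sub>R a + t *\<^sub>R b)) b \<bullet> c)"
  proof (rule mvt_simple[OF h])
    fix t assume "0 \<le> t" "t \<le> h"
    then show "((\<lambda>t. D (w + s *\<^sub>R a + t *\<^sub>R b) \<bullet> c) has_derivative
      (\<lambda>r. r * (frechet_derivative D (at (w + s *\<^sub>R a + t *\<^sub>R b)) b \<bullet> c))) (at t within {0..h})"
      using near[of s t] s ga unfolding D_def[symmetric] by (intro line) simp
  qed
  then obtain t where t: "0 < t" "t < h" and
    T: "D (w + s *\<^sub>R a + h *\<^sub>R b) \<bullet> c - D (w + s *\<^sub>R a) \<bullet> c =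
      h * (frechet_derivative D (at (w + s *\<^sub>R a + t *\<^sub>R b)) b \<bullet> c)"
    by auto
  show thesis
  proof (rule that[folded D_def])
    show "dist (w + s *\<^sub>R a + t *\<^sub>R b) w \<le> 2 * h" using near s t by simp
    show "(g (w + h *\<^sub>R a + h *\<^sub>R b) - g (w + h *\<^sub>R a) - g (w + h *\<^sub>R b) + g w) \<bullet> c =
      h\<^sup>2 * (frechet_derivative D (at (w + s *\<^sub>R a + t *\<^sub>R b)) b \<bullet> c)"
      unfolding S T by (simp add: power2_eq_square)
  qed
qed

text \<open>Testing with \<open>c\<close> equal to the difference of the two sides reduces the vector identity to a single
scalar one.\<close>

lemma mixed_partials:
  fixes g :: "complex \<Rightarrow> 'a::real_inner"
  assumes M: "open M" "w \<in> M" and g: "smooth_on M g"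
  shows "dv (du g) w = du (dv g) w"
proof -
  define c where "c \<equiv> dv (du g) w - du (dv g) w"
  note diff = smooth_onD(1)[OF g] smooth_onD(1)[OF smooth_onD(2)[OF g]]
    smooth_onD(1)[OF smooth_onD(3)[OF g]]
  have "continuous_on M (dv (du g))" "continuous_on M (du (dv g))"
    by (intro smooth_onD g)+
  then have "isCont (dv (du g)) w" "isCont (du (dv g)) w"
    using M by (simp_all add: continuous_on_eq_continuous_at)
  then have cont: "isCont (\<lambda>z. dv (du g) z \<bullet> c) w" "isCont (\<lambda>z. du (dv g) z \<bullet> c) w"
    by (auto intro: continuous_intros)
  have "dv (du g) w \<bullet> c = du (dv g) w \<bullet> c"
  proof (rule ccontr)
    assume ne: "dv (du g) w \<bullet> c \<noteq> du (dv g) w \<bullet> c"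
    \<comment> \<open>Half the gap between the two values, so that their neighbourhoods of radius \<open>e\<close> are disjoint.\<close>
    define e where "e \<equiv> dist (dv (du g) w \<bullet> c) (du (dv g) w \<bullet> c) / 2"
    have e: "e > 0" using ne unfolding e_def by simp
    obtain d1 where d1: "0 < d1" 
      "\<And>z. dist z w < d1 \<Longrightarrow> dist (dv (du g) z \<bullet> c) (dv (du g) w \<bullet> c) < e"
      using e cont(1) unfolding continuous_at_eps_delta dist_real_def by (metis dist_norm)
    obtain d2 where d2: "0 < d2"
      "\<And>z. dist z w < d2 \<Longrightarrow> dist (du (dv g) z \<bullet> c) (du (dv g) w \<bullet> c) < e"
      using e cont(2) unfolding continuous_at_eps_delta dist_real_def by (metis dist_norm)
    obtain r where r: "0 < r" "ball w r \<subseteq> M" using M openE by blast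
    define h where "h \<equiv> min r (min d1 d2) / 3"
    have h: "0 < h" "2 * h < d1" "2 * h < d2" "2 * h < r"
      using d1(1) d2(1) r(1) unfolding h_def by (auto simp: min_def)
    have inM: "z \<in> M" if "dist z w \<le> 2 * h" for z
      using that h r(2) by (auto simp: dist_commute subset_eq)
    have du: "(\<lambda>z. frechet_derivative k (at z) 1) = du k" 
      and dv: "(\<lambda>z. frechet_derivative k (at z) \<i>) = dv k" for k :: "complex \<Rightarrow> 'a"
      unfolding du_def dv_def by auto
    obtain p where p: "dist p w \<le> 2 * h"
      "(g (w + h *\<^sub>R 1 + h *\<^sub>R \<i>) - g (w + h *\<^sub>R 1) - g (w + h *\<^sub>R \<i>) + g w) \<bullet> c =
        h\<^sup>2 * (dv (du g) p \<bullet> c)"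
      using second_difference_mvt[of w h g 1 \<i> c, unfolded du dv_def[symmetric]] 
        diff(1,2)[OF inM] h(1) by auto
    obtain q where q: "dist q w \<le> 2 * h"
      "(g (w + h *\<^sub>R \<i> + h *\<^sub>R 1) - g (w + h *\<^sub>R \<i>) - g (w + h *\<^sub>R 1) + g w) \<bullet> c =
        h\<^sup>2 * (du (dv g) q \<bullet> c)"
      using second_difference_mvt[of w h g \<i> 1 c, unfolded dv du_def[symmetric]]
        diff(1,3)[OF inM] h(1) by auto
    have "h\<^sup>2 * (dv (du g) p \<bullet> c) = h\<^sup>2 * (du (dv g) q \<bullet> c)"
      unfolding p(2)[symmetric] q(2)[symmetric] by (simp add: algebra_simps)
    then have "dv (du g) p \<bullet> c = du (dv g) q \<bullet> c" using h(1) by simp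
    moreover have "dist (dv (du g) p \<bullet> c) (dv (du g) w \<bullet> c) < e"
      "dist (du (dv g) q \<bullet> c) (du (dv g) w \<bullet> c) < e"
      using d1 d2 p(1) q(1) h by auto
    ultimately show False unfolding e_def dist_real_def by argo
  qed
  then have "c \<bullet> c = 0" unfolding c_def by (simp add: inner_diff_left)
  then show ?thesis unfolding c_def by simp
qed

section \<open>Linear algebra of Minkowski space\<close>

lemma bounded_bilinear_mink: "bounded_bilinear (mink :: real^4 \<Rightarrow> real^4 \<Rightarrow> real)"
  unfolding bilinear_conv_bounded_bilinear[symmetric] bilinear_def mink_def
  by (intro conjI allI linearI) (simp_all add: algebra_simps)

interpretation mink: bounded_bilinear "mink :: real^4 \<Rightarrow> real^4 \<Rightarrow> real"
  by (rule bounded_bilinear_mink)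

lemma mink_commute: "mink p q = mink q p"
  by (simp add: mink_def mult.commute)

lemma vector_4:
  "(vector [a, b, c, d] :: 'a::zero^4) $ 1 = a" "(vector [a, b, c, d] :: 'a^4) $ 2 = b"
  "(vector [a, b, c, d] :: 'a^4) $ 3 = c" "(vector [a, b, c, d] :: 'a^4) $ 4 = d"
  unfolding vector_def by simp_all

text \<open>The Lorentz product with \<open>z\<close> is the Euclidean product with the vector obtained from \<open>z\<close> by changing
the sign of its first coordinate, and that vector lies in the kernel of the invertible matrix whose
rows are the frame.\<close>

lemma oriented_frame_nondegenerate:
  assumes "positively_oriented a b c d"
    and "mink a z = 0" "mink b z = 0" "mink c z = 0" "mink d z = 0"
  shows "z = 0"
proof -
  let ?A = "vector [a, b, c, d] :: real^4^4"
  let ?z = "vector [- z$1, z$2, z$3, z$4] :: real^4"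
  have "?A *v ?z = 0"
    using assms(2-) unfolding vec_eq_iff forall_4
    by (simp add: matrix_vector_mult_def sum_4 vector_4 mink_def)
  moreover have "invertible ?A"
    using assms(1) unfolding positively_oriented_def by (simp add: invertible_det_nz)
  ultimately have "?z = 0"
    by (metis invertible_left_inverse matrix_left_invertible_ker)
  then show ?thesis unfolding vec_eq_iff forall_4 by (simp add: vector_4)
qed

text \<open>In a null basis the coefficients are read off crosswise: the component along \<open>a\<close> is detected by
pairing with \<open>b\<close>, and conversely.\<close>

lemma null_frame_expansion:
  assumes frame: "positively_oriented p a b n"
    and null: "mink a a = 0" "mink b b = 0" "mink a b \<noteq> 0"
    and tangent: "mink p a = 0" "mink p b = 0" "mink n a = 0" "mink n b = 0"
    and z: "mink p z = 0" "mink n z = 0"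
  shows "z = (mink z b / mink a b) *\<^sub>R a + (mink z a / mink a b) *\<^sub>R b"
proof -
  let ?d = "z - ((mink z b / mink a b) *\<^sub>R a + (mink z a / mink a b) *\<^sub>R b)"
  have "?d = 0"
    by (rule oriented_frame_nondegenerate[OF frame])
      (use null tangent z in \<open>simp_all add: mink.diff_right mink.add_right mink.scaleR_right
         mink_commute[of a z] mink_commute[of b z] mink_commute[of b a]\<close>)
  then show ?thesis by simp
qed

lemma independent_pair_iff:
  fixes p q :: "'a::real_vector"
  shows "p \<noteq> q \<and> independent {p, q} \<longleftrightarrow>
    (\<forall>s t. s *\<^sub>R p + t *\<^sub>R q = 0 \<longrightarrow> s = 0 \<and> t = 0)" (is "?L \<longleftrightarrow> ?R")
proof
  assume ?L
  then have q: "q \<noteq> 0" and p: "p \<notin> span {q}"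
    by (auto simp: independent_insert)
  show ?R
  proof (intro allI impI)
    fix s t assume st: "s *\<^sub>R p + t *\<^sub>R q = 0"
    have s: "s = 0"
    proof (rule ccontr)
      assume "s \<noteq> 0"
      have "s *\<^sub>R p = - t *\<^sub>R q" using st by (simp add: eq_neg_iff_add_eq_0)
      then have "p = (- t / s) *\<^sub>R q"
        using \<open>s \<noteq> 0\<close> by (metis divide_inverse_commute inverse_inverse_eq scaleR_scaleR
            scaleR_one left_inverse)
      then show False using p by (metis span_base span_mul singletonI)
    qed
    then show "s = 0 \<and> t = 0" using st q by simp
  qed
next
  assume R: ?R
  then have "p \<noteq> q" using R[rule_format, of 1 "-1"] by auto
  moreover have "q \<noteq> 0" using R[rule_format, of 0 1] by auto
  moreover have "p \<notin> span {q}"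
    using R[rule_format, of 1 "- k" for k] by (auto simp: span_singleton)
  ultimately show ?L by (simp add: independent_insert)
qed

text \<open>Eliminating the time coordinate leaves the spacelike vector \<open>d = q\<^sub>1 p - p\<^sub>1 q\<close>, and
\<open>\<langle>d,d\<rangle> = -2 p\<^sub>1 q\<^sub>1 \<langle>p,q\<rangle>\<close>. It follows that \<open>\<langle>p,q\<rangle>\<close> is at most 0, with equality only if \<open>d = 0\<close>,
that is, if \<open>p\<close> and \<open>q\<close> are parallel.\<close>

lemma future_null_mink_neg:
  assumes p: "lightlike p" "future_directed p" and q: "lightlike q" "future_directed q"
    and indep: "p \<noteq> q" "independent {p, q}"
  shows "mink p q < 0"
proof (rule ccontr)
  assume nn: "\<not> mink p q < 0"
  have pos: "p $ 1 > 0" "q $ 1 > 0"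
    using p(2) q(2) unfolding future_directed_def mink_def by (auto simp: axis_def)
  define d where "d \<equiv> (q $ 1) *\<^sub>R p - (p $ 1) *\<^sub>R q"
  have "mink d d = - 2 * (p $ 1 * q $ 1) * mink p q"
    using p(1) q(1) unfolding d_def lightlike_def
    by (simp add: mink.diff_left mink.diff_right mink.scaleR_left mink.scaleR_right mink_commute[of q p])
  then have "mink d d \<le> 0" using nn pos by (simp add: zero_le_mult_iff)
  moreover have d1: "d $ 1 = 0" unfolding d_def by simp
  ultimately have "(d$2)\<^sup>2 + (d$3)\<^sup>2 + (d$4)\<^sup>2 \<le> 0"
    unfolding mink_def by (simp add: power2_eq_square)
  then have "d$2 = 0" "d$3 = 0" "d$4 = 0"
    by (smt (verit) zero_le_power2 power2_less_eq_zero_iff)+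
  then have "d = 0" using d1 unfolding vec_eq_iff forall_4 by simp
  then have "(q $ 1) *\<^sub>R p + (- (p $ 1)) *\<^sub>R q = 0" unfolding d_def by simp
  then show False using indep independent_pair_iff[of p q] pos by (metis less_irrefl)
qed

text \<open>Reversing four rows is an even permutation. This is why exchanging position and normal preserves
the orientation: the minimal case also exchanges the two null directions.\<close>

lemma det_reverse_scale:
  fixes a b c d :: "real^4"
  shows "det (vector [d, t *\<^sub>R c, s *\<^sub>R b, a] :: real^4^4) = s * t * det (vector [a, b, c, d])"
proof -
  let ?\<sigma> = "Transposition.transpose 1 4 \<circ> Transposition.transpose 2 (3::4)"
  have "?\<sigma> permutes UNIV" by (intro permutes_compose permutes_swap_id) auto
  moreover have "sign ?\<sigma> = 1" by (simp add: sign_compose permutation_swap_id sign_swap_id)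
  moreover have "(\<chi> i. (vector [a, s *\<^sub>R b, t *\<^sub>R c, d] :: real^4^4) $ ?\<sigma> i) =
      vector [d, t *\<^sub>R c, s *\<^sub>R b, a]"
    by (subst vec_eq_iff, subst forall_4) (simp add: vector_4 Transposition.transpose_def)
  ultimately have "det (vector [d, t *\<^sub>R c, s *\<^sub>R b, a] :: real^4^4) =
      det (vector [a, s *\<^sub>R b, t *\<^sub>R c, d] :: real^4^4)"
    using det_permute_rows[of ?\<sigma> "vector [a, s *\<^sub>R b, t *\<^sub>R c, d] :: real^4^4"] by simp
  also have "\<dots> = s * det (vector [a, b, t *\<^sub>R c, d] :: real^4^4)"
  proof -
    have row: "vector [a, r, t *\<^sub>R c, d] = (\<chi> i. if i = 2 then r else
        (vector [a, b, t *\<^sub>R c, d] :: real^4^4) $ i)" for r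
      by (subst vec_eq_iff, subst forall_4) (simp add: vector_4)
    have "det (vector [a, s *s b, t *\<^sub>R c, d] :: real^4^4) =
        s * det (vector [a, b, t *\<^sub>R c, d] :: real^4^4)"
      by (subst row[of "s *s b"], subst row[of b], rule det_row_mul)
    then show ?thesis by (simp add: scalar_mult_eq_scaleR)
  qed
  also have "\<dots> = s * t * det (vector [a, b, c, d] :: real^4^4)"
  proof -
    have row: "vector [a, b, r, d] = (\<chi> i. if i = 3 then r else
        (vector [a, b, c, d] :: real^4^4) $ i)" for r
      by (subst vec_eq_iff, subst forall_4) (simp add: vector_4)
    have "det (vector [a, b, t *s c, d] :: real^4^4) =
        t * det (vector [a, b, c, d] :: real^4^4)"
      by (subst row[of "t *s c"], subst row[of c], rule det_row_mul)
    then show ?thesis by (simp add: scalar_mult_eq_scaleR)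
  qed
  finally show ?thesis .
qed

section \<open>A surface and its Gauss map\<close>

lemma mink_constant_derivative:
  assumes "open M" "w \<in> M" "p differentiable (at w)" "q differentiable (at w)"
    and "\<And>z. z \<in> M \<Longrightarrow> mink (p z) (q z) = (k::real)"
  shows "mink (frechet_derivative p (at w) a) (q w) = - mink (p w) (frechet_derivative q (at w) a)"
proof -
  have "frechet_derivative (\<lambda>z. mink (p z) (q z)) (at w) a = frechet_derivative (\<lambda>z. k) (at w) a"
    by (subst frechet_derivative_cong_open[OF assms(1,2,5)]) simp_all
  then show ?thesis
    by (simp add: frechet_derivative_bilinear[OF bounded_bilinear_mink assms(3,4)])
qed

locale surface_with_gauss_map =
  fixes M f \<nu>
  assumes surface: "isotropic_surface M f" and gauss: "gauss_map M f \<nu>"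
begin

lemma open_M: "open M"
  and smooth_maps: "smooth_on M f" "smooth_on M \<nu>"
  using surface gauss unfolding isotropic_surface_def gauss_map_def unit_normal_def by auto

context
  fixes w assumes w: "w \<in> M"
begin

lemma unit: "mink (f w) (f w) = 1" "mink (\<nu> w) (\<nu> w) = 1"
  and perp: "mink (\<nu> w) (f w) = 0" "mink (\<nu> w) (du f w) = 0" "mink (\<nu> w) (dv f w) = 0"
  and frame: "positively_oriented (f w) (du f w) (dv f w) (\<nu> w)"
  and lightlike: "lightlike (du f w)" "lightlike (dv f w)"
  and future: "future_directed (du f w)" "future_directed (dv f w)"
  and immersion: "du f w \<noteq> dv f w" "independent {du f w, dv f w}"
  using surface gauss w unfolding isotropic_surface_def gauss_map_def unit_normal_def by auto

lemma null: "mink (du f w) (du f w) = 0" "mink (dv f w) (dv f w) = 0"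
  and nonzero: "du f w \<noteq> 0" "dv f w \<noteq> 0"
  using lightlike unfolding lightlike_def by auto

lemma metric_neg: "mink (du f w) (dv f w) < 0"
  by (intro future_null_mink_neg lightlike future immersion)

end

text \<open>In this order: \<open>f\<close>, \<open>\<nu>\<close>, \<open>f\<^sub>u\<close>, \<open>f\<^sub>v\<close>, \<open>\<nu>\<^sub>u\<close>, \<open>\<nu>\<^sub>v\<close>.\<close>

lemmas differentiable = smooth_onD(1)[OF smooth_maps(1)] smooth_onD(1)[OF smooth_maps(2)]
  smooth_onD(1)[OF smooth_onD(2)[OF smooth_maps(1)]] smooth_onD(1)[OF smooth_onD(3)[OF smooth_maps(1)]]
  smooth_onD(1)[OF smooth_onD(2)[OF smooth_maps(2)]] smooth_onD(1)[OF smooth_onD(3)[OF smooth_maps(2)]]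

lemma normal_derivative_perp:
  assumes w: "w \<in> M"
  shows "mink (f w) (du f w) = 0" "mink (f w) (dv f w) = 0"
    "mink (f w) (du \<nu> w) = 0" "mink (f w) (dv \<nu> w) = 0"
    "mink (\<nu> w) (du \<nu> w) = 0" "mink (\<nu> w) (dv \<nu> w) = 0"
  using mink_constant_derivative[OF open_M w differentiable(1,1)[OF w], of 1 1]
    mink_constant_derivative[OF open_M w differentiable(1,1)[OF w], of 1 \<i>]
    mink_constant_derivative[OF open_M w differentiable(2,2)[OF w], of 1 1]
    mink_constant_derivative[OF open_M w differentiable(2,2)[OF w], of 1 \<i>]
    mink_constant_derivative[OF open_M w differentiable(2,1)[OF w], of 0 1]
    mink_constant_derivative[OF open_M w differentiable(2,1)[OF w], of 0 \<i>]
    unit perp(1) perp(2,3)[OF w]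
  unfolding du_def[symmetric] dv_def[symmetric]
  by (simp_all add: mink_commute)

text \<open>Each identity differentiates the orthogonality of \<open>\<nu>\<close> and a tangent vector. The two expressions that
involve \<open>II_uv\<close> agree because mixed partial derivatives of \<open>f\<close> commute.\<close>

lemma weingarten:
  assumes w: "w \<in> M"
  shows "mink (du \<nu> w) (du f w) = - II_uu f \<nu> w" "mink (du \<nu> w) (dv f w) = - II_uv f \<nu> w"
    "mink (dv \<nu> w) (du f w) = - II_uv f \<nu> w" "mink (dv \<nu> w) (dv f w) = - II_vv f \<nu> w"
  using mink_constant_derivative[OF open_M w differentiable(2,3)[OF w] perp(2), of 1]
    mink_constant_derivative[OF open_M w differentiable(2,3)[OF w] perp(2), of \<i>]
    mink_constant_derivative[OF open_M w differentiable(2,4)[OF w] perp(3), of 1]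
    mink_constant_derivative[OF open_M w differentiable(2,4)[OF w] perp(3), of \<i>]
    mixed_partials[OF open_M w smooth_maps(1)]
  unfolding du_def[of \<nu>, symmetric] dv_def[of \<nu>, symmetric] 
    du_def[of "du f", symmetric] dv_def[of "du f", symmetric]
    du_def[of "dv f", symmetric] dv_def[of "dv f", symmetric] II_uu_def II_uv_def II_vv_def
  by (simp_all add: mink_commute)

text \<open>The relations \<open>\<langle>f,\<nu>\<^sub>u\<rangle> = \<langle>f,\<nu>\<^sub>v\<rangle> = 0\<close> have the same shape as \<open>\<langle>\<nu>,f\<^sub>u\<rangle> = \<langle>\<nu>,f\<^sub>v\<rangle> = 0\<close>.
Differentiating them gives the same products of first derivatives as in the Weingarten equations.\<close>

lemma second_form_swap:
  assumes w: "w \<in> M"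
  shows "II_uu \<nu> f w = II_uu f \<nu> w" "II_uv \<nu> f w = II_uv f \<nu> w" "II_vv \<nu> f w = II_vv f \<nu> w"
  using mink_constant_derivative[OF open_M w differentiable(1,5)[OF w] normal_derivative_perp(3), of 1]
    mink_constant_derivative[OF open_M w differentiable(1,5)[OF w] normal_derivative_perp(3), of \<i>]
    mink_constant_derivative[OF open_M w differentiable(1,6)[OF w] normal_derivative_perp(4), of \<i>]
    weingarten[OF w]
  unfolding du_def[of f, symmetric] dv_def[of f, symmetric]
    du_def[of "du \<nu>", symmetric] dv_def[of "du \<nu>", symmetric] dv_def[of "dv \<nu>", symmetric]
    II_uu_def[of \<nu>] II_uv_def[of \<nu>] II_vv_def[of \<nu>]
  by (simp_all add: mink_commute)

text \<open>The shape operator in the null frame: the diagonal coefficients \<open>II_uu\<close> and \<open>II_vv\<close> appear with the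
opposite null vector, and the off-diagonal \<open>II_uv\<close> with the same one. Once \<open>II_uv\<close> vanishes, \<open>\<nu>\<close>
therefore exchanges the two null directions.\<close>

lemma normal_derivative:
  assumes w: "w \<in> M"
  defines "F \<equiv> mink (du f w) (dv f w)"
  shows "du \<nu> w = - (II_uv f \<nu> w / F) *\<^sub>R du f w - (II_uu f \<nu> w / F) *\<^sub>R dv f w"
    "dv \<nu> w = - (II_vv f \<nu> w / F) *\<^sub>R du f w - (II_uv f \<nu> w / F) *\<^sub>R dv f w"
proof -
  note expand = null_frame_expansion[OF frame[OF w] null[OF w] less_imp_neq[OF metric_neg[OF w]]
      normal_derivative_perp(1,2)[OF w] perp(2,3)[OF w]]
  show "du \<nu> w = - (II_uv f \<nu> w / F) *\<^sub>R du f w - (II_uu f \<nu> w / F) *\<^sub>R dv f w"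
    "dv \<nu> w = - (II_vv f \<nu> w / F) *\<^sub>R du f w - (II_uv f \<nu> w / F) *\<^sub>R dv f w"
    using expand[OF normal_derivative_perp(3,5)[OF w]] expand[OF normal_derivative_perp(4,6)[OF w]]
    unfolding weingarten[OF w] F_def by simp_all
qed

lemma unit_normal_swap: "unit_normal M \<nu> f"
  using smooth_maps(1) unit perp normal_derivative_perp unfolding unit_normal_def
  by (simp add: mink_commute)

text \<open>In null coordinates the trace of the second fundamental form retains only its mixed coefficient.\<close>

lemma minimal_iff: "minimal M f \<nu> \<longleftrightarrow> (\<forall>w\<in>M. II_uv f \<nu> w = 0)"
proof -
  have "mean_curvature f \<nu> w = 0 \<longleftrightarrow> II_uv f \<nu> w = 0" if "w \<in> M" for w
    using metric_neg[OF that] by (simp add: mean_curvature_def Let_def null[OF that])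
  then show ?thesis unfolding minimal_def by blast
qed

lemma position_not_constant: "\<not> f constant_on M"
proof
  assume "f constant_on M"
  then obtain c where c: "\<And>w. w \<in> M \<Longrightarrow> f w = c" unfolding constant_on_def by blast
  obtain w where w: "w \<in> M" using gauss unfolding gauss_map_def constant_on_def by blast
  have "du f w = 0"
    using frechet_derivative_cong_open[OF open_M w, of f "\<lambda>_. c"] c unfolding du_def by simp
  then show False using nonzero(1)[OF w] by simp
qed

end

section \<open>The minimal case\<close>

locale minimal_surface_with_gauss_map = surface_with_gauss_map +
  assumes minimal: "minimal M f \<nu>"
begin

text \<open>The factors of \<open>\<nu>\<^sub>u\<close> and \<open>\<nu>\<^sub>v\<close> relative to \<open>f\<^sub>v\<close> and \<open>f\<^sub>u\<close>. They have the sign of \<open>II_uu\<close> and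
\<open>II_vv\<close>, since \<open>\<langle>f\<^sub>u,f\<^sub>v\<rangle>\<close> is negative.\<close>

definition "stretch_u w \<equiv> - II_uu f \<nu> w / mink (du f w) (dv f w)"
definition "stretch_v w \<equiv> - II_vv f \<nu> w / mink (du f w) (dv f w)"

lemma normal_derivative_minimal:
  assumes w: "w \<in> M"
  shows "du \<nu> w = stretch_u w *\<^sub>R dv f w" "dv \<nu> w = stretch_v w *\<^sub>R du f w"
  using normal_derivative[OF w] minimal w unfolding minimal_iff stretch_u_def stretch_v_def
  by simp_all

lemma stretch_sign:
  assumes w: "w \<in> M"
  shows "stretch_u w = 0 \<longleftrightarrow> II_uu f \<nu> w = 0" "stretch_v w = 0 \<longleftrightarrow> II_vv f \<nu> w = 0"
    "stretch_u w > 0 \<longleftrightarrow> II_uu f \<nu> w > 0" "stretch_v w > 0 \<longleftrightarrow> II_vv f \<nu> w > 0"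
  using metric_neg[OF w] unfolding stretch_u_def stretch_v_def
  by (auto simp: zero_less_divide_iff divide_less_0_iff)

lemma minimal_swap: "minimal M \<nu> f"
  unfolding minimal_def mean_curvature_def
  using minimal second_form_swap(2)
  by (simp add: Let_def minimal_iff normal_derivative_minimal mink.scaleR_left mink.scaleR_right null)

lemma immersion_iff:
  assumes w: "w \<in> M"
  shows "du \<nu> w \<noteq> dv \<nu> w \<and> independent {du \<nu> w, dv \<nu> w} \<longleftrightarrow> stretch_u w \<noteq> 0 \<and> stretch_v w \<noteq> 0"
proof -
  let ?p = "stretch_u w" and ?q = "stretch_v w"
  have f: "s = 0 \<and> t = 0" if "s *\<^sub>R du f w + t *\<^sub>R dv f w = 0" for s t
    using immersion[OF w] that independent_pair_iff by blast
  have "(\<forall>s t. (t * ?q) *\<^sub>R du f w + (s * ?p) *\<^sub>R dv f w = 0 \<longrightarrow> s = 0 \<and> t = 0) \<longleftrightarrow>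
      ?p \<noteq> 0 \<and> ?q \<noteq> 0" (is "?L \<longleftrightarrow> ?R")
  proof
    assume ?L
    from this[rule_format, of 0 1] this[rule_format, of 1 0] show ?R by auto
  next
    assume ?R
    then show ?L using f[of "_ * ?q" "_ * ?p"] by simp
  qed
  then show ?thesis
    unfolding independent_pair_iff normal_derivative_minimal[OF w] by (simp add: add.commute)
qed

text \<open>Multiples of future directed null vectors are future directed exactly when the factor is positive.
Hence the immersion condition is automatic once both factors are positive, and the only global
condition left is that \<open>\<nu>\<close> be a homeomorphism onto its image.\<close>

lemma isotropic_swap_iff:
  "isotropic_surface M \<nu> \<longleftrightarrow> (\<exists>g. homeomorphism M (\<nu> ` M) \<nu> g) \<and>
     (\<forall>w\<in>M. stretch_u w > 0 \<and> stretch_v w > 0)"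
proof -
  have "lightlike (du \<nu> w) \<and> future_directed (du \<nu> w) \<and> lightlike (dv \<nu> w) \<and> future_directed (dv \<nu> w) \<and>
        du \<nu> w \<noteq> dv \<nu> w \<and> independent {du \<nu> w, dv \<nu> w} \<longleftrightarrow> stretch_u w > 0 \<and> stretch_v w > 0"
    if w: "w \<in> M" for w
  proof -
    have fut: "future_directed (r *\<^sub>R p) \<longleftrightarrow> r > 0" if "future_directed p" for r p
      using that unfolding future_directed_def by (auto simp: mink.scaleR_left mult_less_0_iff)
    have "lightlike (r *\<^sub>R p) \<longleftrightarrow> r \<noteq> 0" if "lightlike p" for r p
      using that unfolding lightlike_def by (auto simp: mink.scaleR_left mink.scaleR_right)
    with fut show ?thesis
      using immersion_iff[OF w] lightlike[OF w] future[OF w]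
      unfolding normal_derivative_minimal[OF w] by auto
  qed
  then show ?thesis
    using surface smooth_maps(2) unit(2) unfolding isotropic_surface_def by blast
qed

lemma gauss_map_swap:
  assumes "isotropic_surface M \<nu>"
  shows "gauss_map M \<nu> f"
proof -
  have "positively_oriented (\<nu> w) (du \<nu> w) (dv \<nu> w) (f w)" if w: "w \<in> M" for w
    using assms w frame[OF w]
    unfolding isotropic_swap_iff positively_oriented_def normal_derivative_minimal[OF w]
      det_reverse_scale by simp
  then show ?thesis
    unfolding gauss_map_def using unit_normal_swap position_not_constant by blast
qed

end

section \<open>The spinor description of the surface\<close>

lemma bounded_bilinear_vector_scalar_mult:
  "bounded_bilinear ((*s) :: complex \<Rightarrow> complex^'n \<Rightarrow> complex^'n)"
  unfolding bilinear_conv_bounded_bilinear[symmetric] bilinear_def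
  by (intro conjI allI linearI) (simp_all add: vec_eq_iff algebra_simps)

lemma bounded_linear_cplx: "bounded_linear (cplx :: real^'n \<Rightarrow> complex^'n)"
  unfolding linear_conv_bounded_linear[symmetric]
  by (intro linearI) (simp_all add: vec_eq_iff cplx_def complex_eq_iff)

lemma bounded_linear_vcnj: "bounded_linear (vcnj :: complex^'n \<Rightarrow> complex^'n)"
  unfolding linear_conv_bounded_linear[symmetric]
  by (intro linearI) (simp_all add: vec_eq_iff vcnj_def complex_eq_iff)

lemma cplx_scaleR: "cplx (r *\<^sub>R p) = complex_of_real r *s cplx p"
  by (simp add: cplx_def vec_eq_iff)

lemma mink_cplx: "mink (cplx p) (cplx q) = complex_of_real (mink p q)"
  by (simp add: mink_def cplx_def)

lemma mink_scale:
  fixes c :: "'a::comm_ring_1"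
  shows "mink (c *s p) q = c * mink p q" "mink p (c *s q) = c * mink p q"
  by (simp_all add: mink_def algebra_simps)

lemma mink_add_diff:
  fixes p q r :: "'a::comm_ring_1^4"
  shows "mink (p + q) r = mink p r + mink q r" "mink (p - q) r = mink p r - mink q r"
  by (simp_all add: mink_def algebra_simps)

context surface_with_gauss_map
begin

text \<open>The shape operator maps \<open>f\<^sub>u\<close> to a multiple of \<open>f\<^sub>v\<close>, and conversely, precisely when its off-diagonal
coefficient vanishes.\<close>

lemma isotropic_condition_iff:
  assumes w: "w \<in> M"
    and u: "cplx (du f w) = complex_of_real a *s L (x w)"
    and v: "cplx (dv f w) = complex_of_real b *s L (y w)"
  shows "isotropic_condition x y \<nu> w \<longleftrightarrow> II_uv f \<nu> w = 0"
proof
  have nz: "a \<noteq> 0" "b \<noteq> 0"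
    using u v nonzero[OF w] by (auto simp: cplx_def vec_eq_iff)
  assume "isotropic_condition x y \<nu> w"
  then obtain r where "cplx (du \<nu> w) = complex_of_real r *s L (y w)"
    unfolding isotropic_condition_def by blast
  then have "complex_of_real b * mink (cplx (du \<nu> w)) (cplx (dv f w)) =
      complex_of_real r * mink (cplx (dv f w)) (cplx (dv f w))"
    unfolding v by (simp add: mink_scale)
  then show "II_uv f \<nu> w = 0"
    using nz by (simp add: mink_cplx null[OF w] weingarten[OF w])
next
  let ?F = "mink (du f w) (dv f w)"
  assume "II_uv f \<nu> w = 0"
  then have du: "du \<nu> w = (- II_uu f \<nu> w / ?F) *\<^sub>R dv f w"
    and dv: "dv \<nu> w = (- II_vv f \<nu> w / ?F) *\<^sub>R du f w"
    using normal_derivative[OF w] by simp_all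
  show "isotropic_condition x y \<nu> w"
    unfolding isotropic_condition_def
  proof (intro conjI exI)
    show "mink (du \<nu> w) (du \<nu> w) = 0" "mink (dv \<nu> w) (dv \<nu> w) = 0"
      unfolding du dv by (simp_all add: mink.scaleR_left mink.scaleR_right mink.minus_left
          mink.minus_right null[OF w])
    show "cplx (du \<nu> w) = complex_of_real (- II_uu f \<nu> w / ?F * b) *s L (y w)"
      "cplx (dv \<nu> w) = complex_of_real (- II_vv f \<nu> w / ?F * a) *s L (x w)"
      unfolding du dv cplx_scaleR u v by (simp_all add: vec_eq_iff)
  qed
qed

end

text \<open>Identify \<open>\<complex>\<^sup>4\<close> with the \<open>2 \<times> 2\<close> matrices so that the Lorentz form becomes a multiple of the
determinant. Then \<open>W x y\<close> is the rank one tensor with factors \<open>(x, 1)\<close> and \<open>(cnj y, 1)\<close>, its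
conjugate is \<open>W y x\<close>, and \<open>L x\<close> is \<open>W x x\<close>. Up to a constant, the product of two rank one
tensors is the product of the determinants formed by their first and by their second factors, so it
vanishes if they share a factor in the same position.\<close>

lemma mink_W_L:
  "mink (W x y) (L x) = 0" "mink (W x y) (L y) = 0"
  "mink (vcnj (W x y)) (L x) = 0" "mink (vcnj (W x y)) (L y) = 0"
  by (simp_all add: mink_def W_def L_def vcnj_def vector_4 complex_eq_iff algebra_simps)

lemma W_differentiable:
  fixes x y :: "complex \<Rightarrow> complex"
  assumes "x differentiable (at w)" "y differentiable (at w)"
  shows "(\<lambda>z. W (x z) (y z)) differentiable (at w)"
    and "(\<lambda>z. vcnj (W (x z) (y z))) differentiable (at w)"
proof -
  have smult: "(\<lambda>z. k z *s v) differentiable (at w)" if "k differentiable (at w)"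
    for k :: "complex \<Rightarrow> complex" and v :: "complex^4"
    by (rule differentiable_bilinear[OF bounded_bilinear_vector_scalar_mult that differentiable_const])
  have cnj: "(\<lambda>z. cnj (y z)) differentiable (at w)"
    by (rule differentiable_linear[OF bounded_linear_cnj assms(2)])
  \<comment> \<open>\<open>W\<close> is affine in each of \<open>x\<close> and \<open>cnj y\<close>; the four constant vectors are its coefficients.\<close>
  have "W (x z) (y z) = (1 *s vector [1, 0, 0, -1] + x z *s vector [0, 1, -\<i>, 0]) +
      (cnj (y z) *s vector [0, 1, \<i>, 0] + (x z * cnj (y z)) *s vector [1, 0, 0, 1])" for z
    by (subst vec_eq_iff, subst forall_4) (simp add: W_def vector_4 algebra_simps)
  then show W: "(\<lambda>z. W (x z) (y z)) differentiable (at w)"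
    by (simp only:) (intro differentiable_add smult differentiable_mult assms(1) cnj differentiable_const)
  then show "(\<lambda>z. vcnj (W (x z) (y z))) differentiable (at w)"
    by (rule differentiable_linear[OF bounded_linear_vcnj])
qed

lemma mink_derivative_scaled_perp:
  fixes S :: "complex \<Rightarrow> complex^4" and m :: "complex \<Rightarrow> complex"
  assumes "m differentiable (at w)" "S differentiable (at w)" "mink (S w) c = 0"
  shows "mink (frechet_derivative (\<lambda>z. m z *s S z) (at w) a) c =
    m w * mink (frechet_derivative S (at w) a) c"
  by (simp add: frechet_derivative_bilinear[OF bounded_bilinear_vector_scalar_mult assms(1,2)]
      mink_scale mink_add_diff assms(3))

text \<open>Pairing with a vector \<open>c\<close> orthogonal to \<open>S w\<close> and \<open>T w\<close> removes the terms with derivatives of the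
scalar factors \<open>m\<close> and \<open>k\<close>. What remains is \<open>2 \<i> \<langle>\<partial>\<^sub>w n, c\<rangle>\<close>, which for real \<open>c\<close> has \<open>\<langle>n\<^sub>v, c\<rangle>\<close> as
real part and \<open>\<langle>n\<^sub>u, c\<rangle>\<close> as imaginary part.\<close>

lemma dw_pairing:
  fixes S T :: "complex \<Rightarrow> complex^4" and n :: "complex \<Rightarrow> real^4" and m k :: "complex \<Rightarrow> complex"
  assumes M: "open M" "w \<in> M"
    and n: "n differentiable (at w)"
    and m: "m differentiable (at w)" and k: "k differentiable (at w)"
    and S: "S differentiable (at w)" "mink (S w) c = 0"
    and T: "T differentiable (at w)" "mink (T w) c = 0"
    and eq: "\<And>z. z \<in> M \<Longrightarrow> cplx (n z) = (1 / (2 * \<i>)) *s (m z *s S z - k z *s T z)"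
  shows "m w * mink (dw S w) c - k w * mink (dw T w) c =
    mink (cplx (dv n w)) c + \<i> * mink (cplx (du n w)) c"
proof -
  have diff: "(\<lambda>z. m z *s S z) differentiable (at w)" "(\<lambda>z. k z *s T z) differentiable (at w)"
    by (intro differentiable_bilinear[OF bounded_bilinear_vector_scalar_mult] m k S(1) T(1))+
  have dir: "mink (cplx (frechet_derivative n (at w) a)) c = (1 / (2 * \<i>)) *
      (m w * mink (frechet_derivative S (at w) a) c - k w * mink (frechet_derivative T (at w) a) c)" for a
  proof -
    have lin: "bounded_linear (\<lambda>v. (1 / (2 * \<i>)) *s v :: complex^4)"
      by (rule bounded_bilinear.bounded_linear_right[OF bounded_bilinear_vector_scalar_mult])
    have "cplx (frechet_derivative n (at w) a) = frechet_derivative (\<lambda>z. cplx (n z)) (at w) a"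
      by (rule frechet_derivative_linear[OF bounded_linear_cplx n, symmetric])
    also have "\<dots> = frechet_derivative (\<lambda>z. (1 / (2 * \<i>)) *s (m z *s S z - k z *s T z)) (at w) a"
      by (subst frechet_derivative_cong_open[OF M eq]) simp_all
    also have "\<dots> = (1 / (2 * \<i>)) *s frechet_derivative (\<lambda>z. m z *s S z - k z *s T z) (at w) a"
      by (rule frechet_derivative_linear[OF lin differentiable_diff[OF diff]])
    also have "frechet_derivative (\<lambda>z. m z *s S z - k z *s T z) (at w) =
        (\<lambda>a. frechet_derivative (\<lambda>z. m z *s S z) (at w) a - frechet_derivative (\<lambda>z. k z *s T z) (at w) a)"
      by (intro frechet_derivative_at[symmetric] has_derivative_diff
          diff[unfolded frechet_derivative_works])
    finally show ?thesis
      by (simp add: mink_scale mink_add_diff mink_derivative_scaled_perp[OF m S]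
          mink_derivative_scaled_perp[OF k T] right_diff_distrib diff_divide_distrib)
  qed
  show ?thesis
    unfolding du_def dv_def dw_def dir mink_scale mink_add_diff
    by (simp add: field_simps)
qed

section \<open>The Gauss map of a minimal isotropic surface\<close>

theorem theorem5p3:
  fixes M :: "complex set"
    and f \<nu> :: "complex \<Rightarrow> real^4"
    and x y \<mu> :: "complex \<Rightarrow> complex"
    and \<alpha> \<beta> :: "complex \<Rightarrow> real"
    and W\<^sub>M W\<^sub>M_bar :: "complex \<Rightarrow> complex^4"
  defines "W\<^sub>M \<equiv> (\<lambda>w. W (x w) (y w))"
    and "W\<^sub>M_bar \<equiv> (\<lambda>w. vcnj (W (x w) (y w)))"
  assumes surface: "isotropic_surface M f"
    and smooth: "smooth_on M x" "smooth_on M y" "smooth_on M \<mu>" "smooth_on M \<alpha>" "smooth_on M \<beta>"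
    and distinct: "\<forall>w\<in>M. x w \<noteq> y w"
    and f_u: "\<forall>w\<in>M. cplx (du f w) = complex_of_real (\<alpha> w) *s L (x w)"
    and f_v: "\<forall>w\<in>M. cplx (dv f w) = complex_of_real (\<beta> w) *s L (y w)"
    and f_eq: "\<forall>w\<in>M. cplx (f w) = (1/2) *s (\<mu> w *s W\<^sub>M w + cnj (\<mu> w) *s W\<^sub>M_bar w)"
    and norm_\<mu>: "\<forall>w\<in>M. complex_of_real ((cmod (\<mu> w))\<^sup>2) * mink (W\<^sub>M w) (W\<^sub>M_bar w) = 2"
    and gauss: "gauss_map M f \<nu>"
    and \<nu>_eq: "\<forall>w\<in>M. cplx (\<nu> w) = (1 / (2 * \<i>)) *s (\<mu> w *s W\<^sub>M w - cnj (\<mu> w) *s W\<^sub>M_bar w)"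
  shows "(minimal M f \<nu> \<and> \<not> totally_geodesic M f \<nu> \<longrightarrow>
            (\<forall>w\<in>M. mink (\<nu> w) (\<nu> w) = 1 \<and> isotropic_condition x y \<nu> w \<and> II_uv \<nu> f w = 0) \<and>
            unit_normal M \<nu> f \<and> \<not> f constant_on M \<and>
            minimal M \<nu> f \<and> \<not> totally_geodesic M \<nu> f \<and>
            (\<forall>w\<in>M. du \<nu> w \<noteq> dv \<nu> w \<and> independent {du \<nu> w, dv \<nu> w} \<longleftrightarrow>
               II_uu f \<nu> w \<noteq> 0 \<and> II_vv f \<nu> w \<noteq> 0) \<and>
            (isotropic_surface M \<nu> \<longleftrightarrow>
               (\<exists>g. homeomorphism M (\<nu> ` M) \<nu> g) \<and>
               (\<forall>w\<in>M. II_uu f \<nu> w > 0 \<and> II_vv f \<nu> w > 0)) \<and>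
            (isotropic_surface M \<nu> \<longrightarrow> gauss_map M \<nu> f))
       \<and> (\<forall>w\<in>M. isotropic_condition x y \<nu> w \<longleftrightarrow>
            Im (\<mu> w * mink (dw W\<^sub>M w) (L (y w)) - cnj (\<mu> w) * mink (dw W\<^sub>M_bar w) (L (y w))) = 0 \<and>
            Re (\<mu> w * mink (dw W\<^sub>M w) (L (x w)) - cnj (\<mu> w) * mink (dw W\<^sub>M_bar w) (L (x w))) = 0)"
proof -
  interpret surface_with_gauss_map M f \<nu>
    using surface gauss by unfold_locales
  have condition: "isotropic_condition x y \<nu> w \<longleftrightarrow> II_uv f \<nu> w = 0" if "w \<in> M" for w
    using isotropic_condition_iff[OF that] f_u f_v that by blast
  have polar: "(\<forall>w\<in>M. mink (\<nu> w) (\<nu> w) = 1 \<and> isotropic_condition x y \<nu> w \<and> II_uv \<nu> f w = 0) \<and>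
            unit_normal M \<nu> f \<and> \<not> f constant_on M \<and>
            minimal M \<nu> f \<and> \<not> totally_geodesic M \<nu> f \<and>
            (\<forall>w\<in>M. du \<nu> w \<noteq> dv \<nu> w \<and> independent {du \<nu> w, dv \<nu> w} \<longleftrightarrow>
               II_uu f \<nu> w \<noteq> 0 \<and> II_vv f \<nu> w \<noteq> 0) \<and>
            (isotropic_surface M \<nu> \<longleftrightarrow>
               (\<exists>g. homeomorphism M (\<nu> ` M) \<nu> g) \<and>
               (\<forall>w\<in>M. II_uu f \<nu> w > 0 \<and> II_vv f \<nu> w > 0)) \<and>
            (isotropic_surface M \<nu> \<longrightarrow> gauss_map M \<nu> f)"
    if min: "minimal M f \<nu>" and tg: "\<not> totally_geodesic M f \<nu>"
  proof -
    interpret minimal_surface_with_gauss_map M f \<nu>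
      using min by unfold_locales
    have uv: "\<forall>w\<in>M. II_uv f \<nu> w = 0" using min minimal_iff by blast
    show ?thesis
    proof (intro conjI)
      show "\<forall>w\<in>M. mink (\<nu> w) (\<nu> w) = 1 \<and> isotropic_condition x y \<nu> w \<and> II_uv \<nu> f w = 0"
        using uv unit(2) condition second_form_swap(2) by simp
      show "\<not> totally_geodesic M \<nu> f"
        using tg unfolding totally_geodesic_def by (simp add: second_form_swap)
      show "\<forall>w\<in>M. du \<nu> w \<noteq> dv \<nu> w \<and> independent {du \<nu> w, dv \<nu> w} \<longleftrightarrow>
               II_uu f \<nu> w \<noteq> 0 \<and> II_vv f \<nu> w \<noteq> 0"
        using immersion_iff stretch_sign by blast
      show "isotropic_surface M \<nu> \<longleftrightarrow> (\<exists>g. homeomorphism M (\<nu> ` M) \<nu> g) \<and>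
               (\<forall>w\<in>M. II_uu f \<nu> w > 0 \<and> II_vv f \<nu> w > 0)"
        using isotropic_swap_iff stretch_sign by blast
    qed (use unit_normal_swap position_not_constant minimal_swap gauss_map_swap in blast)+
  qed
  have "isotropic_condition x y \<nu> w \<longleftrightarrow>
        Im (\<mu> w * mink (dw W\<^sub>M w) (L (y w)) - cnj (\<mu> w) * mink (dw W\<^sub>M_bar w) (L (y w))) = 0 \<and>
        Re (\<mu> w * mink (dw W\<^sub>M w) (L (x w)) - cnj (\<mu> w) * mink (dw W\<^sub>M_bar w) (L (x w))) = 0"
    (is "_ \<longleftrightarrow> Im (?P (y w)) = 0 \<and> Re (?P (x w)) = 0") if w: "w \<in> M" for w
  proof -
    have diff: "x differentiable (at w)" "y differentiable (at w)" "\<mu> differentiable (at w)"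
      using smooth w smooth_onD(1) by blast+
    have cnj: "(\<lambda>z. cnj (\<mu> z)) differentiable (at w)"
      by (rule differentiable_linear[OF bounded_linear_cnj diff(3)])
    have P: "?P z = mink (cplx (dv \<nu> w)) (L z) + \<i> * mink (cplx (du \<nu> w)) (L z)"
      if "z = x w \<or> z = y w" for z
      by (rule dw_pairing[OF open_M w differentiable(2)[OF w] diff(3) cnj])
        (use that W_differentiable[OF diff(1,2)] mink_W_L \<nu>_eq in \<open>auto simp: W\<^sub>M_def W\<^sub>M_bar_def\<close>)
    \<comment> \<open>Multiplying by \<open>\<beta>\<close> or \<open>\<alpha>\<close> turns \<open>L\<close> into a tangent vector of the surface, which is real.\<close>
    have "complex_of_real (\<beta> w) * ?P (y w) =
        mink (cplx (dv \<nu> w)) (cplx (dv f w)) + \<i> * mink (cplx (du \<nu> w)) (cplx (dv f w))"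
      using P[of "y w"] f_v w by (simp add: mink_scale algebra_simps)
    then have Im: "\<beta> w * Im (?P (y w)) = - II_uv f \<nu> w"
      unfolding mink_cplx weingarten[OF w] by (simp add: complex_eq_iff)
    have "complex_of_real (\<alpha> w) * ?P (x w) =
        mink (cplx (dv \<nu> w)) (cplx (du f w)) + \<i> * mink (cplx (du \<nu> w)) (cplx (du f w))"
      using P[of "x w"] f_u w by (simp add: mink_scale algebra_simps)
    then have Re: "\<alpha> w * Re (?P (x w)) = - II_uv f \<nu> w"
      unfolding mink_cplx weingarten[OF w] by (simp add: complex_eq_iff)
    have "\<alpha> w \<noteq> 0" "\<beta> w \<noteq> 0"
      using f_u f_v w nonzero[OF w] by (auto simp: cplx_def vec_eq_iff)
    then show ?thesis
      using Im Re condition[OF w] by (metis mult_eq_0_iff neg_equal_0_iff_equal)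
  qed
  with polar show ?thesis by blast
qed

end
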